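(* Let $X$ be a smooth fan and let $E(X)$ be the set of all endpoints of $X$. Then $\dim(\Lambda(Y))=\dim(Y)$ for every subspace $Y$ of $E(X)$, where $\Lambda(Y)=\{y\in Y : Y \text{ is } 1\text{-dimensional at } y\}$. Thus $E(X)$ does not contain a weakly $1$-dimensional space, i.e. no subspace of $E(X)$ is weakly $1$-dimensional.
   Context: All spaces are separable and metrizable. $\dim$ denotes the usual topological dimension (for separable metrizable spaces the small inductive, large inductive and covering dimensions coincide), with the convention that the empty space is zero-dimensional, i.e. $\dim(\varnothing)=0$: a space is zero-dimensional if it has a neighbourhood basis of clopen sets, which holds vacuously for $\varnothing$. The Cantor fan is the cone over the Cantor set. A smooth fan is a compact, connected subset of the Cantor fan. An endpoint of a smooth fan $X$ is a point $x\in X$ that is an endpoint of every arc in $X$ containing $x$. A space $Y$ is zero-dimensional at $y\in Y$ if every neighbourhood of $y$ in $Y$ contains a clopen (in $Y$) neighbourhood of $y$. $Y$ is $1$-dimensional at $y$ if $Y$ is not zero-dimensional at $y$ but every neighbourhood of $y$ contains an open neighbourhood of $y$ whose boundary has dimension at most $0$. (If $\dim(Y)\le 1$, then $Y$ is $1$-dimensional at $y$ if and only if $Y$ is not zero-dimensional at $y$.) A space $Y$ is weakly $1$-dimensional if $\dim(Y)=1$ but $\dim(\Lambda(Y))=0$. *)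

theory Defs
  imports "HOL-Analysis.Analysis"
begin

text \<open>
  The library relation \<open>X dim_le n\<close> is the small inductive dimension, normalised so that only the
  empty space satisfies \<open>X dim_le -1\<close>. Taking the infimum over natural numbers \<open>n\<close> gives the
  empty space dimension \<open>0\<close>; the value is \<open>\<infinity>\<close> if no \<open>n\<close> works.
\<close>

definition topdim :: "'a topology \<Rightarrow> enat" where
  "topdim X = Inf {enat n | n. X dim_le int n}"

definition zero_dimensional_at :: "'a topology \<Rightarrow> 'a \<Rightarrow> bool" where
  "zero_dimensional_at Y y \<longleftrightarrow> neighbourhood_base_at y (\<lambda>U. openin Y U \<and> closedin Y U) Y"

definition one_dimensional_at :: "'a topology \<Rightarrow> 'a \<Rightarrow> bool" where
  "one_dimensional_at Y y \<longleftrightarrow>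
     \<not> zero_dimensional_at Y y \<and>
     neighbourhood_base_at y
       (\<lambda>U. openin Y U \<and> topdim (subtopology Y (Y frontier_of U)) \<le> 0) Y"

definition dim_kernel :: "'a topology \<Rightarrow> 'a set" where
  "dim_kernel Y = {y \<in> topspace Y. one_dimensional_at Y y}"

definition weakly_one_dimensional :: "'a topology \<Rightarrow> bool" where
  "weakly_one_dimensional Y \<longleftrightarrow>
     topdim Y = 1 \<and> topdim (subtopology Y (dim_kernel Y)) = 0"

primrec cantor_stage :: "nat \<Rightarrow> real set" where
  "cantor_stage 0 = {0..1}"
| "cantor_stage (Suc n) = (\<lambda>x. x / 3) ` cantor_stage n \<union> (\<lambda>x. 2 / 3 + x / 3) ` cantor_stage n"

definition cantor_set :: "real set" where
  "cantor_set = (\<Inter>n. cantor_stage n)"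

text \<open>
  \<open>K\<close> is (a copy of) the cone over \<open>T\<close>: the quotient of \<open>T \<times> [0,1]\<close> in which \<open>T \<times> {1}\<close> is
  collapsed to a point. Stated for an arbitrary quotient map, so that every homeomorphic
  model of the cone is covered.
\<close>

definition is_cone_over :: "'a topology \<Rightarrow> 'b topology \<Rightarrow> bool" where
  "is_cone_over K T \<longleftrightarrow>
     (\<exists>q. quotient_map (prod_topology T (top_of_set {0..1::real})) K q \<and>
          (\<forall>x \<in> topspace T \<times> {0..1}. \<forall>y \<in> topspace T \<times> {0..1}.
             q x = q y \<longleftrightarrow> x = y \<or> (snd x = 1 \<and> snd y = 1)))"

definition cantor_fan :: "'a topology \<Rightarrow> bool" where
  "cantor_fan K \<longleftrightarrow> is_cone_over K (top_of_set cantor_set)"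

definition smooth_fan :: "'a topology \<Rightarrow> bool" where
  "smooth_fan X \<longleftrightarrow>
     (\<exists>K S. cantor_fan K \<and> compactin K S \<and> connectedin K S \<and> X = subtopology K S)"

text \<open>An arc in \<open>X\<close> is an embedded copy of \<open>[0,1]\<close>; its endpoints are the images of \<open>0\<close> and \<open>1\<close>.\<close>

definition fan_endpoints :: "'a topology \<Rightarrow> 'a set" where
  "fan_endpoints X =
     {x \<in> topspace X. \<forall>g. embedding_map (top_of_set {0..1::real}) X g \<and> x \<in> g ` {0..1} \<longrightarrow>
                          x = g 0 \<or> x = g 1}"

end

theory Submission
  imports Defs
begin

text \<open>
  If \<open>X\<close> meets several blades, a set \<open>Y\<close> of endpoints is the graph of a lower semicontinuous function
  \<open>\<phi>\<close> over a subset \<open>A\<close> of the Cantor set, so \<open>dim Y \<le> 1\<close>, and it suffices to show that \<open>Y\<close> is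
  zero-dimensional whenever \<open>\<Lambda>(Y)\<close> is. Given \<open>e > 0\<close>, let \<open>C\<close> be the set of points of \<open>Y\<close> that lie
  in no clopen set on which \<open>\<phi>\<close> oscillates by less than \<open>e\<close>. Then \<open>C\<close> is contained in \<open>\<Lambda>(Y)\<close>, hence
  zero-dimensional, and after refining the topology of \<open>A\<close> by countably many clopen subsets of \<open>Y\<close> it
  is closed already in \<open>A\<close>. This makes \<open>C\<close> a retract of \<open>Y\<close>, so that a clopen subset of \<open>C\<close> on which
  \<open>\<phi>\<close> is small extends to a clopen subset of \<open>Y\<close>. As \<open>Y - C\<close> is partitioned into relatively clopen
  pieces of oscillation less than \<open>e\<close>, the pieces on which \<open>\<phi>\<close> is large can be discarded from that
  set without losing clopenness.
\<close>

section \<open>Dimension\<close>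

text \<open>A nonempty infimum in \<open>enat\<close> is attained and \<open>dim_le\<close> is
  monotone in its bound, so the infimum reduces to a single witness.\<close>

lemma topdim_le_iff: "topdim X \<le> enat n \<longleftrightarrow> X dim_le int n"
proof
  let ?A = "{enat n | n. X dim_le int n}"
  assume le: "topdim X \<le> enat n"
  then have "?A \<noteq> {}"
    by (force simp: topdim_def top_enat_def)
  then have "topdim X \<in> ?A"
    unfolding topdim_def Inf_enat_def by (metis (no_types, lifting) LeastI_ex all_not_in_conv)
  then obtain m where "topdim X = enat m" "X dim_le int m" by auto
  then show "X dim_le int n"
    using le dimension_le_mono by fastforce
next
  assume "X dim_le int n"
  then show "topdim X \<le> enat n"
    unfolding topdim_def by (intro Inf_lower) auto
qed

lemma topdim_le_0_iff: "topdim X \<le> 0 \<longleftrightarrow> X dim_le 0"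
  using topdim_le_iff [of X 0] by (simp add: zero_enat_def)

lemma topdim_eqI: "(\<And>n. X dim_le int n \<longleftrightarrow> Y dim_le int n) \<Longrightarrow> topdim X = topdim Y"
  by (simp add: topdim_def)

lemma dim_le_0_iff_zero_dimensional_at:
  "X dim_le 0 \<longleftrightarrow> (\<forall>x \<in> topspace X. zero_dimensional_at X x)"
  unfolding dimension_le_0_neighbourhood_base_of_clopen neighbourhood_base_of_def
    zero_dimensional_at_def by (simp add: conj_commute)

lemma zero_dimensional_atD:
  assumes "zero_dimensional_at X x" "openin X W" "x \<in> W"
  obtains V where "openin X V" "closedin X V" "x \<in> V" "V \<subseteq> W"
  using assms unfolding zero_dimensional_at_def neighbourhood_base_at_def by blast

section \<open>Graphs of lower semicontinuous functions\<close>

text \<open>The classes of this relation act as basic neighbourhoods in the coarser topology of the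
  domain, which is present only through the sequence \<open>H\<close>.\<close>

definition agree :: "(nat \<Rightarrow> 'a set) \<Rightarrow> nat \<Rightarrow> 'a \<Rightarrow> 'a \<Rightarrow> bool" where
  "agree H n x y \<longleftrightarrow> (\<forall>i<n. x \<in> H i \<longleftrightarrow> y \<in> H i)"

lemma agree_refl [simp]: "agree H n x x"
  by (simp add: agree_def)

lemma agree_sym: "agree H n x y \<Longrightarrow> agree H n y x"
  by (simp add: agree_def)

lemma agree_trans: "agree H n x y \<Longrightarrow> agree H n y z \<Longrightarrow> agree H n x z"
  by (simp add: agree_def)

lemma agree_mono: "agree H n x y \<Longrightarrow> m \<le> n \<Longrightarrow> agree H m x y"
  by (simp add: agree_def)

text \<open>
  \<open>T\<close> is the topology of the graph of \<open>\<phi>\<close> over a space whose (zero-dimensional, coarser) topology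
  is generated by the clopen sets \<open>H i\<close>.
\<close>

locale lsc_graph =
  fixes T :: "'a topology" and H :: "nat \<Rightarrow> 'a set" and \<phi> :: "'a \<Rightarrow> real"
  assumes openH: "openin T (H i)" and closedH: "closedin T (H i)"
    and cont: "continuous_map T euclideanreal \<phi>"
    and lsc: "\<lbrakk>x \<in> topspace T; 0 < e\<rbrakk> \<Longrightarrow> \<exists>n. \<forall>y \<in> topspace T. agree H n x y \<longrightarrow> \<phi> x - e < \<phi> y"
    and basis: "\<lbrakk>openin T G; x \<in> G\<rbrakk> \<Longrightarrow>
      \<exists>n e. 0 < e \<and> (\<forall>y \<in> topspace T. agree H n x y \<and> \<phi> y < \<phi> x + e \<longrightarrow> y \<in> G)"
begin

section \<open>Clopen classes and the bound on the dimension\<close>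

definition cls :: "nat \<Rightarrow> 'a \<Rightarrow> 'a set" where
  "cls n x = {y \<in> topspace T. agree H n x y}"

lemma cls_clopen: "openin T (cls n x) \<and> closedin T (cls n x)"
proof (induction n)
  case 0
  then show ?case by (simp add: cls_def agree_def)
next
  case (Suc n)
  have "cls (Suc n) x = (if x \<in> H n then cls n x \<inter> H n else cls n x - H n)"
    by (auto simp: cls_def agree_def less_Suc_eq)
  then show ?case
    using Suc openH [of n] closedH [of n] by (auto intro: openin_diff closedin_diff)
qed

lemma openin_cls: "openin T (cls n x)" and closedin_cls: "closedin T (cls n x)"
  using cls_clopen by auto

lemma self_cls: "x \<in> topspace T \<Longrightarrow> x \<in> cls n x"
  by (simp add: cls_def)

lemma openin_less: "openin T {y \<in> topspace T. \<phi> y < r}"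
  using openin_continuous_map_preimage [OF cont, of "{..<r}"] by simp

lemma closedin_le: "closedin T {y \<in> topspace T. \<phi> y \<le> r}"
  using closedin_continuous_map_preimage [OF cont, of "{..r}"] by simp

text \<open>On a level set the height condition in \<open>basis\<close> holds by itself, so the
  clopen classes alone form a neighbourhood base.\<close>

lemma dim_le_0_level: "subtopology T {y \<in> topspace T. \<phi> y = r} dim_le 0" (is "subtopology T ?S dim_le 0")
  unfolding dim_le_0_iff_zero_dimensional_at zero_dimensional_at_def neighbourhood_base_at_def
proof clarify
  fix x W
  assume "x \<in> topspace (subtopology T ?S)" "openin (subtopology T ?S) W" and x: "x \<in> W"
  then obtain G where G: "openin T G" "W = G \<inter> ?S"
    by (auto simp: openin_subtopology)
  then obtain n e where ne: "0 < e" "\<And>y. \<lbrakk>y \<in> topspace T; agree H n x y; \<phi> y < \<phi> x + e\<rbrakk> \<Longrightarrow> y \<in> G"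
    using basis [OF G(1)] x by blast
  have "cls n x \<inter> ?S \<subseteq> W"
    using ne x G by (auto simp: cls_def)
  moreover have "openin (subtopology T ?S) (cls n x \<inter> ?S)" "closedin (subtopology T ?S) (cls n x \<inter> ?S)"
    using openin_cls closedin_cls unfolding openin_subtopology closedin_subtopology by blast+
  moreover have "x \<in> cls n x \<inter> ?S"
    using x G self_cls by auto
  ultimately show "\<exists>U V. openin (subtopology T ?S) U \<and>
      (openin (subtopology T ?S) V \<and> closedin (subtopology T ?S) V) \<and> x \<in> U \<and> U \<subseteq> V \<and> V \<subseteq> W"
    by blast
qed

text \<open>A clopen class contributes nothing to the frontier, so cutting it at height
  \<open>\<phi> x + e\<close> leaves a frontier inside a single level set.\<close>

lemma small_frontier_base:
  assumes "openin T W" "x \<in> W"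
  obtains U where "openin T U" "x \<in> U" "U \<subseteq> W" "subtopology T (T frontier_of U) dim_le 0"
proof -
  obtain n e where ne: "0 < e" "\<And>y. \<lbrakk>y \<in> topspace T; agree H n x y; \<phi> y < \<phi> x + e\<rbrakk> \<Longrightarrow> y \<in> W"
    using basis [OF assms] by blast
  let ?U = "cls n x \<inter> {y \<in> topspace T. \<phi> y < \<phi> x + e}"
  have x: "x \<in> topspace T"
    using assms openin_subset by blast
  have op: "openin T ?U"
    by (intro openin_Int openin_cls openin_less)
  have "T closure_of ?U \<subseteq> cls n x \<inter> {y \<in> topspace T. \<phi> y \<le> \<phi> x + e}"
    by (intro closure_of_minimal closedin_Int closedin_cls closedin_le) auto
  then have "T frontier_of ?U \<subseteq> {y \<in> topspace T. \<phi> y = \<phi> x + e}"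
    unfolding frontier_of_def using op by (auto simp: interior_of_openin)
  then have "subtopology T (T frontier_of ?U) dim_le 0"
    using dim_le_0_level dimension_le_subtopologies by blast
  moreover have "x \<in> ?U" "?U \<subseteq> W"
    using ne x self_cls by (auto simp: cls_def)
  ultimately show thesis
    using that op by blast
qed

lemma dim_le_1: "T dim_le 1"
proof (rule dimension_le.intros)
  fix V a assume "openin T V" "a \<in> V"
  then obtain U where "openin T U" "a \<in> U" "U \<subseteq> V" "subtopology T (T frontier_of U) dim_le 0"
    by (rule small_frontier_base)
  then show "\<exists>U. a \<in> U \<and> U \<subseteq> V \<and> openin T U \<and> subtopology T (T frontier_of U) dim_le 1 - 1"
    by auto
qed simp

text \<open>Small frontiers are available at every point, so membership in the kernel is decided by
  zero-dimensionality alone.\<close>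

lemma dim_kernel_eq: "dim_kernel T = {x \<in> topspace T. \<not> zero_dimensional_at T x}"
proof -
  have "neighbourhood_base_at x (\<lambda>U. openin T U \<and> topdim (subtopology T (T frontier_of U)) \<le> 0) T" for x
    unfolding neighbourhood_base_at_def topdim_le_0_iff by (meson small_frontier_base subset_refl)
  then show ?thesis
    by (auto simp: dim_kernel_def one_dimensional_at_def)
qed

section \<open>The core, the pieces of its complement, and extension of clopen sets\<close>

definition small :: "real \<Rightarrow> 'a set \<Rightarrow> bool" where
  "small e V \<longleftrightarrow> (\<forall>z\<in>V. \<forall>w\<in>V. \<phi> z < \<phi> w + e)"

text \<open>Only classes of the current sequence \<open>H\<close> are tested, so the core shrinks
  when \<open>H\<close> is refined; this is how it is later brought inside the kernel.\<close>

definition core :: "real \<Rightarrow> 'a set" where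
  "core e = {y \<in> topspace T. \<forall>n. \<not> small e (cls n y)}"

lemma cls_eq: "agree H n x y \<Longrightarrow> cls n x = cls n y"
  by (simp add: cls_def agree_def)

lemma core_small_disjoint: "small e (cls n y) \<Longrightarrow> cls n y \<inter> core e = {}"
proof -
  assume "small e (cls n y)"
  then have "z \<notin> core e" if "z \<in> cls n y" for z
    using that cls_eq [of n y z] by (auto simp: core_def cls_def)
  then show ?thesis by blast
qed

lemma closedin_core: "closedin T (core e)"
proof -
  have "topspace T - core e = \<Union>{cls n y | n y. small e (cls n y)}"
  proof (intro equalityI subsetI)
    fix x assume "x \<in> topspace T - core e"
    then obtain n where "small e (cls n x)" "x \<in> cls n x"
      using self_cls by (auto simp: core_def)
    then show "x \<in> \<Union>{cls n y | n y. small e (cls n y)}" by blast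
  next
    fix x assume "x \<in> \<Union>{cls n y | n y. small e (cls n y)}"
    then obtain n y where "small e (cls n y)" "x \<in> cls n y" by blast
    then show "x \<in> topspace T - core e"
      using core_small_disjoint [of e n y] by (auto simp: cls_def)
  qed
  then have "openin T (topspace T - core e)"
    using openin_cls by auto
  moreover have "core e \<subseteq> topspace T"
    by (auto simp: core_def)
  ultimately show ?thesis
    by (simp add: closedin_def)
qed

text \<open>Meaningful only off the core, where some class is small; on the core
  \<open>LEAST\<close> has no witness.\<close>

definition depth :: "real \<Rightarrow> 'a \<Rightarrow> nat" where
  "depth e y = (LEAST n. small e (cls n y))"

text \<open>The classes of a point decrease with the level. Stopping at the first small one gives
  the largest small class, and these classes partition the complement of the core.\<close>

definition piece :: "real \<Rightarrow> 'a \<Rightarrow> 'a set" where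
  "piece e y = cls (depth e y) y"

lemma small_piece:
  assumes "y \<in> topspace T - core e"
  shows "small e (piece e y)"
  using assms unfolding piece_def depth_def core_def by (auto intro: LeastI)

text \<open>Points of a piece have the same class at every level up to its depth, so for each of
  them the search for a small class ends at the same level.\<close>

lemma piece_eq:
  assumes y: "y \<in> topspace T - core e" and z: "z \<in> piece e y"
  shows "z \<in> topspace T - core e" "depth e z = depth e y" "piece e z = piece e y"
proof -
  have ag: "agree H (depth e y) y z"
    using z by (simp add: piece_def cls_def)
  have small: "small e (cls (depth e y) y)"
    using small_piece [OF y] by (simp add: piece_def)
  show "z \<in> topspace T - core e"
    using core_small_disjoint [OF small] z by (auto simp: piece_def cls_def)
  show d: "depth e z = depth e y"
    unfolding depth_def [of e z]
  proof (rule Least_equality)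
    show "small e (cls (depth e y) z)"
      using small cls_eq [OF ag] by simp
  next
    fix n assume n: "small e (cls n z)"
    show "depth e y \<le> n"
    proof (rule ccontr)
      assume "\<not> depth e y \<le> n"
      then have "cls n y = cls n z"
        using cls_eq ag agree_mono by (metis nle_le)
      then show False
        using n \<open>\<not> depth e y \<le> n\<close> Least_le [of "\<lambda>n. small e (cls n y)" n]
        by (simp add: depth_def)
    qed
  qed
  show "piece e z = piece e y"
    using cls_eq [OF ag] d by (simp add: piece_def)
qed

text \<open>A class containing a core point is never small, so the search at \<open>y\<close> goes
  past every level on which \<open>y\<close> agrees with \<open>x\<close>. Pieces thus become finer
  on approach to the core.\<close>

lemma depth_gt:
  assumes x: "x \<in> core e" and y: "y \<in> topspace T - core e" and ag: "agree H n x y"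
  shows "n < depth e y"
proof (rule ccontr)
  assume "\<not> n < depth e y"
  then have "x \<in> piece e y"
    using x agree_sym [OF agree_mono [OF ag, of "depth e y"]] by (auto simp: piece_def cls_def core_def)
  then show False
    using piece_eq(1) [OF y] x by blast
qed

text \<open>
  The idea behind the bound on \<open>\<phi> p\<close>: by lower semicontinuity, a point lying at most
  marginally higher than a nearby point of the core is close to it in the graph.
\<close>

definition attracts :: "real \<Rightarrow> 'a set \<Rightarrow> nat \<Rightarrow> 'a \<Rightarrow> bool" where
  "attracts e A n y \<longleftrightarrow>
     (\<exists>p\<in>A. agree H n p y \<and> (\<forall>z \<in> piece e y. \<phi> p \<le> \<phi> z + 1 / real (Suc n)))"

text \<open>Agreement and permitted excess in height both tighten as \<open>n\<close> grows. The
  levels at which a set attracts \<open>y\<close> therefore form an initial segment, and two sets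
  can be compared by these segments.\<close>

lemma attracts_antimono:
  assumes "attracts e A n y" "m \<le> n"
  shows "attracts e A m y"
proof -
  have "1 / real (Suc n) \<le> 1 / real (Suc m)"
    using assms(2) by (simp add: frac_le)
  then show ?thesis
    using assms unfolding attracts_def by (meson add_left_mono agree_mono order_trans)
qed

text \<open>Agreement with a core point at level \<open>n\<close> forces the depth beyond
  \<open>n\<close>, so the whole piece shares it; the height condition already ranges over the
  piece.\<close>

lemma attracts_piece:
  assumes "A \<subseteq> core e" "y \<in> topspace T - core e" "z \<in> piece e y"
  shows "attracts e A n y \<longleftrightarrow> attracts e A n z"
proof -
  have imp: "attracts e A n z'" if "attracts e A n y'" "y' \<in> topspace T - core e" "z' \<in> piece e y'" for y' z'
  proof -
    obtain p where p: "p \<in> A" "agree H n p y'" "\<forall>z \<in> piece e y'. \<phi> p \<le> \<phi> z + 1 / real (Suc n)"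
      using \<open>attracts e A n y'\<close> by (auto simp: attracts_def)
    have "n < depth e y'"
      using depth_gt p assms(1) that(2) by blast
    then have "agree H n y' z'"
      using that(3) by (auto simp: piece_def cls_def intro: agree_mono)
    then have "agree H n p z'"
      using agree_trans [OF p(2)] by simp
    then show ?thesis
      using p piece_eq(3) [OF that(2,3)] by (auto simp: attracts_def)
  qed
  have "y \<in> piece e z"
    using piece_eq [OF assms(2,3)] assms(2) self_cls by (auto simp: piece_def)
  then show ?thesis
    using imp [of y z] imp [of z y] assms piece_eq(1) [OF assms(2,3)] by blast
qed

text \<open>Near \<open>x\<close> the point \<open>x\<close> itself attracts, by lower
  semicontinuity. A rival \<open>p\<close> in \<open>B\<close> attracting at the same level would
  agree with \<open>x\<close> and be only slightly higher, so \<open>basis\<close> would put it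
  outside \<open>B\<close>.\<close>

lemma attracted_near:
  assumes "A \<subseteq> core e" "B \<subseteq> core e" "x \<in> A" "closedin T B" "x \<notin> B"
  shows "\<exists>N. openin T N \<and> x \<in> N \<and> N \<inter> B = {} \<and>
           (\<forall>y \<in> N - core e. \<exists>n. attracts e A n y \<and> \<not> attracts e B n y)"
proof -
  have x: "x \<in> topspace T" "x \<in> core e"
    using assms by (auto simp: core_def)
  then have "openin T (topspace T - B)" "x \<in> topspace T - B"
    using assms by auto
  then obtain k d where d: "0 < d"
      and kd: "\<And>y. \<lbrakk>y \<in> topspace T; agree H k x y; \<phi> y < \<phi> x + d\<rbrakk> \<Longrightarrow> y \<notin> B"
    using basis [of "topspace T - B" x] by blast
  \<comment> \<open>\<open>n\<close> must reach the level \<open>k\<close> that separates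
    \<open>x\<close> from \<open>B\<close>. A slack below \<open>d / 2\<close>, added to the height
    cut at \<open>\<phi> x + d / 2\<close>, keeps a rival below \<open>\<phi> x + d\<close>.\<close>
  obtain n where n: "k \<le> n" "1 / real (Suc n) < d / 2"
  proof -
    obtain m where m: "1 / real (Suc m) < d / 2"
      using d nat_approx_posE [of "d/2"] by auto
    have "1 / real (Suc (max k m)) \<le> 1 / real (Suc m)"
      by (simp add: frac_le)
    then show thesis
      using that [of "max k m"] m by linarith
  qed
  obtain j where j: "\<And>y. \<lbrakk>y \<in> topspace T; agree H j x y\<rbrakk> \<Longrightarrow> \<phi> x - 1 / real (Suc n) < \<phi> y"
    using lsc [OF x(1), of "1 / real (Suc n)"] by auto
  define M where "M = max n j"
  let ?N = "cls M x \<inter> {y \<in> topspace T. \<phi> y < \<phi> x + d / 2}"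
  have "openin T ?N"
    by (intro openin_Int openin_cls openin_less)
  moreover have "x \<in> ?N"
    using x d self_cls by auto
  moreover have "?N \<inter> B = {}"
  proof -
    have "y \<notin> B" if "y \<in> ?N" for y
      using that kd [of y] d n agree_mono [of H M x y k] by (auto simp: cls_def M_def)
    then show ?thesis by blast
  qed
  moreover have "attracts e A n y \<and> \<not> attracts e B n y" if y: "y \<in> ?N - core e" for y
  proof
    have yT: "y \<in> topspace T - core e" and ag: "agree H M x y" and lt: "\<phi> y < \<phi> x + d / 2"
      using y by (auto simp: cls_def)
    have dep: "M < depth e y"
      using depth_gt [OF x(2) yT ag] .
    \<comment> \<open>Since the depth exceeds \<open>M\<close>, the whole piece stays in the class
      of \<open>x\<close> where the lower bound from \<open>lsc\<close> holds.\<close>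
    have "\<phi> x \<le> \<phi> z + 1 / real (Suc n)" if "z \<in> piece e y" for z
    proof -
      have "z \<in> topspace T" "agree H M y z"
        using that dep by (auto simp: piece_def cls_def intro: agree_mono)
      then have "agree H j x z"
        using agree_trans [OF ag] agree_mono [of H M x z j] by (simp add: M_def)
      then show ?thesis
        using j [OF \<open>z \<in> topspace T\<close>] by force
    qed
    then show "attracts e A n y"
      using assms(3) ag agree_mono [of H M x y n] by (auto simp: attracts_def M_def)
    show "\<not> attracts e B n y"
    proof
      assume "attracts e B n y"
      then obtain p where p: "p \<in> B" "agree H n p y" "\<forall>z \<in> piece e y. \<phi> p \<le> \<phi> z + 1 / real (Suc n)"
        by (auto simp: attracts_def)
      have "\<phi> p < \<phi> x + d"
        using p(3) self_cls [of y] yT lt n(2) by (force simp: piece_def)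
      moreover have "agree H k x p"
        using agree_trans [OF agree_mono [OF ag] agree_sym [OF agree_mono [OF p(2) n(1)]]] n(1)
        by (simp add: M_def)
      moreover have "p \<in> topspace T"
        using p assms by (auto simp: core_def)
      ultimately show False
        using kd p by blast
    qed
  qed
  ultimately show ?thesis by blast
qed

text \<open>
  The \<open>attracts\<close> comparison extends a clopen subset of the core to a clopen set; off the core
  the pieces have oscillation less than \<open>e\<close>, so they can be cut off at a given height.
\<close>

lemma clopen_near_core:
  assumes "0 < e" and dim: "subtopology T (core e) dim_le 0" and x0: "x0 \<in> core e"
  obtains W where "openin T W" "closedin T W" "x0 \<in> W" "\<And>y. y \<in> W \<Longrightarrow> \<phi> y < \<phi> x0 + 2 * e"
proof -
  let ?K = "core e"
  have KT: "?K \<subseteq> topspace T" by (auto simp: core_def)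
  let ?L = "{y \<in> topspace T. \<phi> y < \<phi> x0 + e}"
  have "zero_dimensional_at (subtopology T ?K) x0"
    using dim x0 KT by (auto simp: dim_le_0_iff_zero_dimensional_at)
  moreover have "openin (subtopology T ?K) (?K \<inter> ?L)"
    using openin_less openin_subtopology_Int2 by blast
  moreover have "x0 \<in> ?K \<inter> ?L"
    using x0 KT \<open>0 < e\<close> by auto
  ultimately obtain E where E: "openin (subtopology T ?K) E" "closedin (subtopology T ?K) E"
      "x0 \<in> E" "E \<subseteq> ?K \<inter> ?L"
    by (rule zero_dimensional_atD)
  define F where "F = ?K - E"
  have "closedin (subtopology T ?K) F"
    unfolding F_def using E(1) KT by (metis closedin_diff closedin_topspace inf.absorb_iff2 topspace_subtopology)
  then have cF: "closedin T F"
    using closedin_core closedin_trans_full by blast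
  have cE: "closedin T E"
    using E closedin_core closedin_trans_full by blast
  have EK: "E \<subseteq> ?K" and FK: "F \<subseteq> ?K"
    using E by (auto simp: F_def)
  \<comment> \<open>The first condition says that \<open>E\<close> attracts strictly deeper than
    \<open>F\<close>; the second discards pieces lying entirely at height
    \<open>\<phi> x0 + e\<close> or more. Both depend only on the piece of \<open>y\<close>.\<close>
  define good where "good y \<longleftrightarrow> (\<exists>n. attracts e E n y \<and> \<not> attracts e F n y) \<and>
                                (\<exists>z \<in> piece e y. \<phi> z < \<phi> x0 + e)" for y
  define W where "W = E \<union> {y \<in> topspace T - ?K. good y}"
  have good_piece: "good z = good y" if "y \<in> topspace T - ?K" "z \<in> piece e y" for y z
    unfolding good_def using that attracts_piece [OF EK that] attracts_piece [OF FK that] piece_eq(3) [OF that]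
    by simp
  have piece_nhd: "openin T (piece e y)" "y \<in> piece e y" if "y \<in> topspace T - ?K" for y
    using that openin_cls self_cls by (auto simp: piece_def)
  have "openin T W"
    unfolding openin_subopen [of T W]
  proof
    fix x assume "x \<in> W"
    then consider "x \<in> E" | "x \<in> topspace T - ?K" "good x" by (auto simp: W_def)
    then show "\<exists>N. openin T N \<and> x \<in> N \<and> N \<subseteq> W"
    proof cases
      case 1
      then obtain N where N: "openin T N" "x \<in> N" "N \<inter> F = {}"
          "\<forall>y \<in> N - ?K. \<exists>n. attracts e E n y \<and> \<not> attracts e F n y"
        using attracted_near [OF EK FK _ cF, of x] by (auto simp: F_def)
      \<comment> \<open>Intersecting with \<open>?L\<close> secures the second condition of
        \<open>good\<close>, with \<open>y\<close> itself as the low point of its piece.\<close>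
      have "N \<inter> ?L \<subseteq> W"
      proof
        fix y assume y: "y \<in> N \<inter> ?L"
        show "y \<in> W"
        proof (cases "y \<in> ?K")
          case True
          then show ?thesis using y N by (auto simp: W_def F_def)
        next
          case False
          then have "good y"
            unfolding good_def using y N(4) piece_nhd(2) by blast
          then show ?thesis using False y by (auto simp: W_def)
        qed
      qed
      moreover have "openin T (N \<inter> ?L)" "x \<in> N \<inter> ?L"
        using N openin_less 1 E by auto
      ultimately show ?thesis by blast
    next
      case 2
      have "y \<in> W" if "y \<in> piece e x" for y
        using piece_eq(1) [OF 2(1) that] good_piece [OF 2(1) that] 2(2) unfolding W_def by blast
      then have "piece e x \<subseteq> W" by blast
      then show ?thesis using piece_nhd [OF 2(1)] by blast
    qed
  qed
  moreover have "openin T (topspace T - W)"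
    unfolding openin_subopen [of T "topspace T - W"]
  proof
    fix x assume "x \<in> topspace T - W"
    then consider "x \<in> F" | "x \<in> topspace T - ?K" "\<not> good x" by (auto simp: W_def F_def)
    then show "\<exists>N. openin T N \<and> x \<in> N \<and> N \<subseteq> topspace T - W"
    proof cases
      case 1
      then obtain N where N: "openin T N" "x \<in> N" "N \<inter> E = {}"
          "\<forall>y \<in> N - ?K. \<exists>n. attracts e F n y \<and> \<not> attracts e E n y"
        using attracted_near [OF FK EK _ cE, of x] by (auto simp: F_def)
      \<comment> \<open>Attracting levels form initial segments, so \<open>F\<close> reaching deeper
        than \<open>E\<close> excludes the opposite.\<close>
      have "\<not> good y" if "y \<in> N - ?K" for y
        using N(4) that attracts_antimono unfolding good_def by (metis nle_le)
      then have "N \<subseteq> topspace T - W"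
        using N openin_subset [OF N(1)] by (auto simp: W_def)
      then show ?thesis using N by blast
    next
      case 2
      have "y \<in> topspace T - W" if "y \<in> piece e x" for y
        using piece_eq(1) [OF 2(1) that] good_piece [OF 2(1) that] 2(2) EK unfolding W_def by blast
      then have "piece e x \<subseteq> topspace T - W" by blast
      then show ?thesis using piece_nhd [OF 2(1)] by blast
    qed
  qed
  moreover have "W \<subseteq> topspace T"
    using EK KT by (auto simp: W_def)
  \<comment> \<open>Off the core one \<open>e\<close> bounds the low point of the piece and the
    other its oscillation.\<close>
  moreover have "\<phi> y < \<phi> x0 + 2 * e" if "y \<in> W" for y
  proof (cases "y \<in> E")
    case True
    then show ?thesis using E(4) \<open>0 < e\<close> by fastforce
  next
    case False
    then have y: "y \<in> topspace T - ?K" "good y" using that by (auto simp: W_def)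
    then obtain z where "z \<in> piece e y" "\<phi> z < \<phi> x0 + e" by (auto simp: good_def)
    moreover have "\<phi> y < \<phi> z + e"
      using small_piece [OF y(1)] calculation(1) piece_nhd(2) [OF y(1)] by (auto simp: small_def)
    ultimately show ?thesis by simp
  qed
  moreover have "x0 \<in> W" using E by (auto simp: W_def)
  ultimately show thesis
    using that by (auto simp: closedin_def)
qed

section \<open>Refinement of the clopen sets and comparison with the kernel\<close>

lemma refine:
  assumes "\<And>i. openin T (V i)" "\<And>i. closedin T (V i)"
  shows "lsc_graph T (\<lambda>i. if even i then H (i div 2) else V (i div 2)) \<phi>"
proof -
  let ?H = "\<lambda>i. if even i then H (i div 2) else V (i div 2)"
  \<comment> \<open>Even indices carry the old sets, so agreement on \<open>2 * n\<close> new sets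
    includes agreement on \<open>n\<close> old ones. The assumptions \<open>lsc\<close> and
    \<open>basis\<close> use agreement only as a sufficient condition and so survive.\<close>
  have ag: "agree H n x y" if "agree ?H (2 * n) x y" for n x y
  proof -
    have "x \<in> H i \<longleftrightarrow> y \<in> H i" if "i < n" for i
    proof -
      have "x \<in> ?H (2 * i) \<longleftrightarrow> y \<in> ?H (2 * i)"
        using \<open>agree ?H (2 * n) x y\<close> [unfolded agree_def, rule_format, of "2 * i"] \<open>i < n\<close> by simp
      then show ?thesis by simp
    qed
    then show ?thesis by (simp add: agree_def)
  qed
  show ?thesis
  proof
    show "openin T (?H i)" "closedin T (?H i)" for i
      using assms openH closedH by auto
    show "continuous_map T euclideanreal \<phi>" by (rule cont)
    show "\<exists>n. \<forall>y \<in> topspace T. agree ?H n x y \<longrightarrow> \<phi> x - e < \<phi> y" if "x \<in> topspace T" "0 < e" for x e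
      using lsc [OF that] ag by blast
    show "\<exists>n e. 0 < e \<and> (\<forall>y \<in> topspace T. agree ?H n x y \<and> \<phi> y < \<phi> x + e \<longrightarrow> y \<in> G)"
      if "openin T G" "x \<in> G" for x G
      using basis [OF that] ag by blast
  qed
qed

end

text \<open>Refining \<open>H\<close> by clopen sets of small oscillation forces the core into the
  kernel. The core is then zero-dimensional, so \<open>clopen_near_core\<close> handles its points;
  off the core a small class serves directly.\<close>

lemma (in lsc_graph) zero_dimensional_if_dim_kernel:
  assumes sc: "second_countable T"
    and dim: "subtopology T (dim_kernel T) dim_le 0"
  shows "T dim_le 0"
  unfolding dim_le_0_iff_zero_dimensional_at
proof (rule ballI, rule ccontr)
  fix x0 assume x0: "x0 \<in> topspace T" "\<not> zero_dimensional_at T x0"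
  then obtain G where G: "openin T G" "x0 \<in> G"
      and noV: "\<And>V. \<lbrakk>openin T V; closedin T V; x0 \<in> V; V \<subseteq> G\<rbrakk> \<Longrightarrow> False"
    unfolding zero_dimensional_at_def neighbourhood_base_at_def by blast
  then obtain n0 d where d: "0 < d"
      and nd: "\<And>y. \<lbrakk>y \<in> topspace T; agree H n0 x0 y; \<phi> y < \<phi> x0 + d\<rbrakk> \<Longrightarrow> y \<in> G"
    using basis [OF G] by blast
  \<comment> \<open>Intersecting with a class of \<open>x0\<close> puts a clopen neighbourhood of
    bounded height inside \<open>G\<close>, so only an upper bound on \<open>\<phi>\<close> has to
    be arranged.\<close>
  have noW: False if W: "openin T W" "closedin T W" "x0 \<in> W" "\<And>y. y \<in> W \<Longrightarrow> \<phi> y < \<phi> x0 + d" for W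
  proof (rule noV)
    show "openin T (cls n0 x0 \<inter> W)" "closedin T (cls n0 x0 \<inter> W)"
      using W openin_cls closedin_cls by auto
    show "x0 \<in> cls n0 x0 \<inter> W"
      using W x0 self_cls by auto
    show "cls n0 x0 \<inter> W \<subseteq> G"
      using W nd by (auto simp: cls_def)
  qed
  define e where "e = d / 2"
  have e: "0 < e" using d by (simp add: e_def)
  let ?C = "{V. openin T V \<and> closedin T V \<and> small e V}"
  have "openin T (\<Union>?C)" by blast
  \<comment> \<open>The family \<open>?C\<close> may be uncountable, while refining \<open>H\<close>
    calls for a sequence covering the same points.\<close>
  then have "Lindelof_space (subtopology T (\<Union>?C))"
    using sc second_countable_imp_Lindelof_space second_countable_subtopology by blast
  then obtain \<V> where \<V>: "countable \<V>" "\<V> \<subseteq> ?C" "\<Union>?C \<subseteq> \<Union>\<V>"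
    using openin_subset unfolding Lindelof_space_subtopology_subset [OF openin_subset [OF \<open>openin T (\<Union>?C)\<close>]]
    by (metis (no_types, lifting) mem_Collect_eq order_refl)
  \<comment> \<open>The empty set keeps the enumeration total even when \<open>\<V>\<close> is
    empty; it is clopen and vacuously small.\<close>
  define V where "V = from_nat_into (insert {} \<V>)"
  have cnt: "countable (insert {} \<V>)" using \<V> by simp
  have V: "V i \<in> insert {} \<V>" for i
    unfolding V_def by (rule from_nat_into) simp
  have Vclopen: "openin T (V i)" "closedin T (V i)" and Vsmall: "small e (V i)" for i
    using V [of i] \<V>(2) by (auto simp: small_def)
  interpret R: lsc_graph T "\<lambda>i. if even i then H (i div 2) else V (i div 2)" \<phi>
    using refine Vclopen by blast
  have notcore: "y \<notin> R.core e" if U: "openin T U" "closedin T U" "small e U" "y \<in> U" for y U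
  proof -
    obtain A where "A \<in> \<V>" "y \<in> A" using U \<V>(3) by blast
    then obtain i where i: "y \<in> V i"
      using from_nat_into_to_nat_on [OF cnt, of A] unfolding V_def by (metis insertI2)
    \<comment> \<open>\<open>V i\<close> sits at index \<open>2 * i + 1\<close> of the refined
      sequence, so level \<open>2 * i + 2\<close> is the first to test it.\<close>
    have "R.cls (2 * i + 2) y \<subseteq> V i"
    proof
      fix z assume z: "z \<in> R.cls (2 * i + 2) y"
      then have "y \<in> (if even (2*i+1) then H ((2*i+1) div 2) else V ((2*i+1) div 2)) \<longleftrightarrow>
                 z \<in> (if even (2*i+1) then H ((2*i+1) div 2) else V ((2*i+1) div 2))"
        unfolding R.cls_def agree_def by auto
      then show "z \<in> V i" using i by simp
    qed
    then have "R.small e (R.cls (2 * i + 2) y)"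
      using Vsmall [of i] unfolding small_def R.small_def by blast
    then show ?thesis by (auto simp: R.core_def)
  qed
  have core: "R.core e \<subseteq> dim_kernel T"
  proof
    fix y assume y: "y \<in> R.core e"
    have yT: "y \<in> topspace T" using y by (auto simp: R.core_def)
    have "\<not> zero_dimensional_at T y"
    proof
      assume z: "zero_dimensional_at T y"
      have "openin T {w \<in> topspace T. \<phi> w \<in> {\<phi> y - e/2 <..< \<phi> y + e/2}}"
        by (rule openin_continuous_map_preimage [OF cont]) simp
      moreover have "y \<in> {w \<in> topspace T. \<phi> w \<in> {\<phi> y - e/2 <..< \<phi> y + e/2}}"
        using yT e by simp
      ultimately obtain U where U: "openin T U" "closedin T U" "y \<in> U"
          "U \<subseteq> {w \<in> topspace T. \<phi> w \<in> {\<phi> y - e/2 <..< \<phi> y + e/2}}"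
        by (rule zero_dimensional_atD [OF z])
      then have "\<phi> v < \<phi> w + e" if "v \<in> U" "w \<in> U" for v w
        using subsetD [OF U(4) that(1)] subsetD [OF U(4) that(2)] by auto
      then have "small e U"
        unfolding small_def by blast
      then show False
        using notcore U y by blast
    qed
    then show "y \<in> dim_kernel T"
      using yT by (simp add: dim_kernel_eq)
  qed
  show False
  proof (cases "x0 \<in> R.core e")
    case True
    have "subtopology T (R.core e) dim_le 0"
      using dim core dimension_le_subtopologies by blast
    then obtain W where "openin T W" "closedin T W" "x0 \<in> W" "\<And>y. y \<in> W \<Longrightarrow> \<phi> y < \<phi> x0 + 2 * e"
      using R.clopen_near_core [OF e _ True] by blast
    then show False
      by (intro noW [of W]) (simp_all add: e_def)
  next
    case False
    then obtain n where "R.small e (R.cls n x0)"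
      using x0 by (auto simp: R.core_def)
    then have "\<phi> y < \<phi> x0 + d" if "y \<in> R.cls n x0" for y
      using that R.self_cls [OF x0(1), of n] e by (force simp: R.small_def e_def)
    then show False
      by (rule noW [OF R.openin_cls R.closedin_cls R.self_cls [OF x0(1)]])
  qed
qed

lemma dim_kernel_subset: "dim_kernel T \<subseteq> topspace T"
  by (auto simp: dim_kernel_def)

lemma topdim_dim_kernel_zero:
  assumes "T dim_le 0"
  shows "topdim (subtopology T (dim_kernel T)) = topdim T"
proof (rule topdim_eqI)
  fix n
  have "T dim_le int n"
    using assms dimension_le_mono by fastforce
  then show "subtopology T (dim_kernel T) dim_le int n \<longleftrightarrow> T dim_le int n"
    using dimension_le_subtopology by blast
qed

text \<open>As the dimension of \<open>T\<close> is at most 1, the two sides could differ only on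
  the bound 0.\<close>

lemma (in lsc_graph) topdim_dim_kernel:
  assumes "second_countable T"
  shows "topdim (subtopology T (dim_kernel T)) = topdim T"
proof (rule topdim_eqI)
  fix n
  show "subtopology T (dim_kernel T) dim_le int n \<longleftrightarrow> T dim_le int n"
  proof (cases n)
    case 0
    then show ?thesis
      using zero_dimensional_if_dim_kernel [OF assms] dimension_le_subtopology by auto
  next
    case (Suc m)
    then have "T dim_le int n"
      using dim_le_1 dimension_le_mono [of T 1] by simp
    then show ?thesis
      using dimension_le_subtopology by blast
  qed
qed

section \<open>The Cantor set\<close>

lemma compact_cantor_stage: "compact (cantor_stage n)"
proof (induction n)
  case (Suc n)
  have "continuous_on (cantor_stage n) (\<lambda>x. x / 3)" "continuous_on (cantor_stage n) (\<lambda>x. 2 / 3 + x / 3)"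
    by (auto intro!: continuous_intros)
  then show ?case
    using Suc by (auto intro!: compact_Un compact_continuous_image)
qed simp

lemma compact_cantor_set: "compact cantor_set"
  unfolding cantor_set_def by (intro compact_Inter) (auto simp: compact_cantor_stage)

lemma cantor_stage_subset: "cantor_stage n \<subseteq> {0..1}"
  by (induction n) auto

text \<open>The point \<open>1 / 2\<close> is removed at the first step, so the interval lies on one
  side of it; magnifying that third by 3 gives an interval in the preceding stage.\<close>

lemma interval_in_cantor_stage:
  assumes "a \<le> b" "{a..b} \<subseteq> cantor_stage n"
  shows "b - a \<le> (1 / 3) ^ n"
  using assms
proof (induction n arbitrary: a b)
  case 0
  then show ?case by auto
next
  case (Suc n)
  have L: "x \<le> 1 / 3" if "x \<in> (\<lambda>x. x / 3) ` cantor_stage n" for x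
    using that cantor_stage_subset [of n] by auto
  have R: "2 / 3 \<le> x" if "x \<in> (\<lambda>x. 2 / 3 + x / 3) ` cantor_stage n" for x
    using that cantor_stage_subset [of n] by auto
  have "1 / 2 \<notin> {a..b}"
  proof
    assume "1 / 2 \<in> {a..b}"
    then have "1 / 2 \<in> cantor_stage (Suc n)"
      using Suc.prems(2) by blast
    then show False
      using L [of "1/2"] R [of "1/2"] unfolding cantor_stage.simps by fastforce
  qed
  then consider "b < 1 / 2" | "1 / 2 < a" by force
  then show ?case
  proof cases
    case 1
    have "{3 * a..3 * b} \<subseteq> cantor_stage n"
    proof
      fix x assume "x \<in> {3 * a..3 * b}"
      then have "x / 3 \<in> {a..b}" by auto
      then have "x / 3 \<in> cantor_stage (Suc n)" "x / 3 < 2 / 3"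
        using subsetD [OF Suc.prems(2)] 1 by auto
      then show "x \<in> cantor_stage n"
        using R [of "x / 3"] unfolding cantor_stage.simps by fastforce
    qed
    then show ?thesis
      using Suc.IH [of "3 * a" "3 * b"] Suc.prems(1) by (simp add: field_simps)
  next
    case 2
    have "{3 * a - 2..3 * b - 2} \<subseteq> cantor_stage n"
    proof
      fix x assume "x \<in> {3 * a - 2..3 * b - 2}"
      then have "2 / 3 + x / 3 \<in> {a..b}" by (auto simp: field_simps)
      then have "2 / 3 + x / 3 \<in> cantor_stage (Suc n)" "1 / 3 < 2 / 3 + x / 3"
        using subsetD [OF Suc.prems(2)] 2 by auto
      then show "x \<in> cantor_stage n"
        using L [of "2 / 3 + x / 3"] unfolding cantor_stage.simps by fastforce
    qed
    then show ?thesis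
      using Suc.IH [of "3 * a - 2" "3 * b - 2"] Suc.prems(1) by (simp add: field_simps)
  qed
qed

text \<open>Points outside the Cantor set cut it into clopen parts, and rational ones form a
  countable supply. They exist because the Cantor set is closed and contains no interval of positive
  length.\<close>

lemma rational_gap:
  assumes "a < b"
  obtains r where "r \<in> \<rat> - cantor_set" "a < r" "r < b"
proof -
  obtain n where n: "(1 / 3) ^ n < (b - a) / 2"
    using real_arch_pow_inv [of "(b - a) / 2" "1/3"] assms by auto
  define a' b' where "a' = a + (b - a) / 4" and "b' = b - (b - a) / 4"
  have ab: "a < a'" "a' < b'" "b' < b" "b' - a' = (b - a) / 2"
    using assms by (auto simp: a'_def b'_def field_simps)
  then have "\<not> {a'..b'} \<subseteq> cantor_stage n"
    using interval_in_cantor_stage [of a' b' n] n by fastforce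
  then obtain z where z: "z \<in> {a'..b'}" "z \<notin> cantor_stage n"
    by blast
  then have nz: "z \<notin> cantor_set"
    unfolding cantor_set_def by blast
  have "open (- cantor_set \<inter> {a<..<b})"
    using compact_cantor_set by (intro open_Int) (auto simp: compact_imp_closed)
  moreover have "z \<in> - cantor_set \<inter> {a<..<b}"
    using z nz ab by auto
  ultimately obtain d where d: "0 < d" "ball z d \<subseteq> - cantor_set \<inter> {a<..<b}"
    by (meson openE)
  obtain r where "r \<in> \<rat>" "z < r" "r < z + d"
    using Rats_dense_in_real [of z "z + d"] d by auto
  then have "r \<in> ball z d" by (auto simp: dist_real_def)
  then have "r \<in> - cantor_set \<inter> {a<..<b}"
    using d(2) by blast
  then show thesis
    using that [of r] \<open>r \<in> \<rat>\<close> by auto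
qed

section \<open>Fans\<close>

locale fan =
  fixes K :: "'a topology" and q :: "real \<times> real \<Rightarrow> 'a" and S :: "'a set"
  assumes quotient: "quotient_map (top_of_set (cantor_set \<times> {0..1})) K q"
    and ident: "\<And>x y. \<lbrakk>x \<in> cantor_set \<times> {0..1}; y \<in> cantor_set \<times> {0..1}\<rbrakk> \<Longrightarrow>
                  q x = q y \<longleftrightarrow> x = y \<or> (snd x = 1 \<and> snd y = 1)"
    and compact_S: "compactin K S" and connected_S: "connectedin K S"
begin

text \<open>The height \<open>\<tau>\<close> is independent of the chosen representative, but
  \<open>\<gamma>\<close> is arbitrary at the vertex, which has height 1.\<close>

definition coords :: "'a \<Rightarrow> real \<times> real" where
  "coords x = (SOME p. p \<in> cantor_set \<times> {0..1} \<and> q p = x)"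

definition \<gamma> :: "'a \<Rightarrow> real" where "\<gamma> x = fst (coords x)"

definition \<tau> :: "'a \<Rightarrow> real" where "\<tau> x = snd (coords x)"

lemma topspace_K: "topspace K = q ` (cantor_set \<times> {0..1})"
  using quotient_imp_surjective_map [OF quotient] by simp

lemma
  assumes "x \<in> topspace K"
  shows \<gamma>_in: "\<gamma> x \<in> cantor_set" and \<tau>_in: "\<tau> x \<in> {0..1}" and q_coords: "q (\<gamma> x, \<tau> x) = x"
proof -
  obtain p where "p \<in> cantor_set \<times> {0..1} \<and> q p = x"
    using assms unfolding topspace_K by blast
  then have "coords x \<in> cantor_set \<times> {0..1} \<and> q (coords x) = x"
    unfolding coords_def by (rule someI)
  then show "\<gamma> x \<in> cantor_set" "\<tau> x \<in> {0..1}" "q (\<gamma> x, \<tau> x) = x"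
    by (auto simp: \<gamma>_def \<tau>_def mem_Times_iff)
qed

lemma q_in: "\<lbrakk>c \<in> cantor_set; t \<in> {0..1}\<rbrakk> \<Longrightarrow> q (c, t) \<in> topspace K"
  by (auto simp: topspace_K)

lemma \<tau>_q:
  assumes "c \<in> cantor_set" "t \<in> {0..1}"
  shows "\<tau> (q (c, t)) = t"
  using ident [of "(\<gamma> (q (c, t)), \<tau> (q (c, t)))" "(c, t)"] q_in [OF assms] q_coords \<gamma>_in \<tau>_in assms
  by auto

lemma \<gamma>_q:
  assumes "c \<in> cantor_set" "t \<in> {0..1}" "t \<noteq> 1"
  shows "\<gamma> (q (c, t)) = c"
  using ident [of "(\<gamma> (q (c, t)), \<tau> (q (c, t)))" "(c, t)"] q_in [OF assms(1,2)] q_coords \<gamma>_in \<tau>_in assms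
  by auto

lemma q_eq_iff:
  "\<lbrakk>c \<in> cantor_set; t \<in> {0..1}; c' \<in> cantor_set; t' \<in> {0..1}\<rbrakk> \<Longrightarrow>
     q (c, t) = q (c', t') \<longleftrightarrow> t = t' \<and> (c = c' \<or> t = 1)"
  using ident [of "(c, t)" "(c', t')"] by auto

lemma continuous_\<tau>: "continuous_map K euclideanreal \<tau>"
proof (rule continuous_compose_quotient_map [OF quotient])
  have "continuous_map (top_of_set (cantor_set \<times> {0..1})) euclideanreal (snd :: real \<times> real \<Rightarrow> real)"
    by (simp add: continuous_on_snd)
  then show "continuous_map (top_of_set (cantor_set \<times> {0..1})) euclideanreal (\<tau> \<circ> q)"
    by (rule continuous_map_eq) (auto simp: \<tau>_q)
qed

text \<open>At the vertex \<open>\<gamma>\<close> depends on a choice, but the factor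
  \<open>1 - \<tau> x\<close> vanishes there, so the composite with \<open>q\<close> is a polynomial
  in the coordinates.\<close>

lemma continuous_width: "continuous_map K euclideanreal (\<lambda>x. (1 - \<tau> x) * \<gamma> x)"
proof (rule continuous_compose_quotient_map [OF quotient])
  have "continuous_map (top_of_set (cantor_set \<times> {0..1})) euclideanreal (\<lambda>p :: real \<times> real. (1 - snd p) * fst p)"
    by (auto intro!: continuous_intros)
  then show "continuous_map (top_of_set (cantor_set \<times> {0..1})) euclideanreal ((\<lambda>x. (1 - \<tau> x) * \<gamma> x) \<circ> q)"
    by (rule continuous_map_eq) (clarsimp, metis \<tau>_q \<gamma>_q atLeastAtMost_iff diff_self mult_zero_left)
qed

text \<open>This draws the cone in the plane with apex (0, 1). Below height 1 the blade is recovered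
  from the first coordinate. Separation and countability of \<open>K\<close> are inherited from the
  plane.\<close>

lemma plane_map:
  shows "continuous_map K euclidean (\<lambda>x. ((1 - \<tau> x) * \<gamma> x, \<tau> x))" (is "continuous_map K _ ?h")
    and "inj_on (\<lambda>x. ((1 - \<tau> x) * \<gamma> x, \<tau> x)) (topspace K)"
proof -
  have "continuous_map K (prod_topology euclideanreal euclideanreal) ?h"
    by (intro continuous_map_pairedI continuous_\<tau> continuous_width)
  then show "continuous_map K euclidean ?h"
    using prod_topology_subtopology_eu [of UNIV UNIV] by simp
  show "inj_on ?h (topspace K)"
  proof (rule inj_onI)
    fix x y assume xy: "x \<in> topspace K" "y \<in> topspace K" "?h x = ?h y"
    then have "q (\<gamma> x, \<tau> x) = q (\<gamma> y, \<tau> y)"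
      using q_eq_iff [OF \<gamma>_in \<tau>_in \<gamma>_in \<tau>_in] by auto
    then show "x = y"
      using q_coords xy by simp
  qed
qed

lemma Hausdorff_K: "Hausdorff_space K"
  using Hausdorff_space_injective_preimage [OF _ plane_map] by simp

lemma compact_cone: "compact (cantor_set \<times> {0..1::real})"
  by (intro compact_Times compact_cantor_set) simp

lemma compact_K: "compact_space K"
proof -
  have "compactin K (q ` (cantor_set \<times> {0..1}))"
    by (rule image_compactin [OF _ quotient_imp_continuous_map [OF quotient]])
       (simp add: compactin_subtopology compact_cone)
  then show ?thesis by (simp add: compact_space_def topspace_K)
qed

lemma second_countable_K: "second_countable K"
proof -
  have "embedding_map K euclidean (\<lambda>x. ((1 - \<tau> x) * \<gamma> x, \<tau> x))"
    using continuous_imp_embedding_map [OF plane_map(1) compact_K _ plane_map(2)] by simp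
  then have "K homeomorphic_space (top_of_set ((\<lambda>x. ((1 - \<tau> x) * \<gamma> x, \<tau> x)) ` topspace K))"
    by (rule embedding_map_imp_homeomorphic_space)
  moreover have "second_countable (euclidean :: (real \<times> real) topology)"
  proof -
    obtain \<B> :: "(real \<times> real) set set" where \<B>: "countable \<B>" "\<And>V. V \<in> \<B> \<Longrightarrow> open V"
        "\<And>U. open U \<Longrightarrow> \<exists>\<U>. \<U> \<subseteq> \<B> \<and> U = \<Union>\<U>"
      by (rule univ_second_countable) blast
    have "\<exists>V\<in>\<B>. x \<in> V \<and> V \<subseteq> U" if "open U" "x \<in> U" for x U
      using \<B>(3) [OF that(1)] that(2) by blast
    then show ?thesis
      unfolding second_countable_def using \<B>(1,2) by (auto intro!: exI [of _ \<B>])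
  qed
  ultimately show ?thesis
    using homeomorphic_space_second_countability second_countable_subtopology by blast
qed

section \<open>The preimage of the fan in the cylinder\<close>

lemma S_subset: "S \<subseteq> topspace K"
  using compact_S compactin_subset_topspace by blast

text \<open>In the cylinder both coordinates are continuous. If the vertex lies in \<open>S\<close>,
  this set contains all of \<open>cantor_set \<times> {1}\<close>, whatever value
  \<open>\<gamma>\<close> takes there.\<close>

definition preS :: "(real \<times> real) set" where
  "preS = {p \<in> cantor_set \<times> {0..1}. q p \<in> S}"

lemma compact_preS: "compact preS"
proof -
  have "closedin K S"
    using compactin_imp_closedin [OF Hausdorff_K compact_S] .
  then have "closedin (top_of_set (cantor_set \<times> {0..1})) preS"
    using closedin_continuous_map_preimage [OF quotient_imp_continuous_map [OF quotient], of S]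
    by (simp add: preS_def)
  then show ?thesis
    using compact_cone by (meson closedin_compact)
qed

lemma closed_slice:
  assumes "closed A"
  shows "closed (fst ` (preS \<inter> UNIV \<times> A))"
proof -
  have "compact (preS \<inter> UNIV \<times> A)"
    using assms by (intro compact_Int_closed compact_preS closed_Times) auto
  then have "compact (fst ` (preS \<inter> UNIV \<times> A))"
    by (intro compact_continuous_image continuous_on_fst continuous_on_id)
  then show ?thesis by (rule compact_imp_closed)
qed

text \<open>A form of the tube lemma: by compactness of \<open>preS\<close>, a blade that misses the
  heights in \<open>A\<close> has neighbours that miss them too.\<close>

lemma slice_nhd:
  assumes "closed A" "c \<notin> fst ` (preS \<inter> UNIV \<times> A)"
  obtains d where "0 < d" "\<And>c' t. \<lbrakk>\<bar>c' - c\<bar> < d; (c', t) \<in> preS\<rbrakk> \<Longrightarrow> t \<notin> A"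
proof -
  have "open (- (fst ` (preS \<inter> UNIV \<times> A)))"
    using closed_slice [OF assms(1)] by blast
  then obtain d where d: "0 < d" "ball c d \<subseteq> - (fst ` (preS \<inter> UNIV \<times> A))"
    using assms(2) by (meson ComplI openE)
  have "t \<notin> A" if "\<bar>c' - c\<bar> < d" "(c', t) \<in> preS" for c' t
  proof
    assume "t \<in> A"
    then have "c' \<in> fst ` (preS \<inter> UNIV \<times> A)"
      using that(2) by force
    moreover have "c' \<in> ball c d"
      using that(1) by (simp add: dist_real_def abs_minus_commute)
    ultimately show False using d(2) by blast
  qed
  then show thesis using that d(1) by blast
qed

section \<open>Arcs and blades inside the fan\<close>

lemma not_endpoint:
  fixes g :: "real \<Rightarrow> 'a"
  assumes "continuous_map (top_of_set {0..1}) K g" "inj_on g {0..1}" "g ` {0..1} \<subseteq> S" "0 < s" "s < 1"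
  shows "g s \<notin> fan_endpoints (subtopology K S)"
proof
  assume e: "g s \<in> fan_endpoints (subtopology K S)"
  have "continuous_map (top_of_set {0..1}) (subtopology K S) g"
    using assms by (auto simp: continuous_map_in_subtopology)
  then have "embedding_map (top_of_set {0..1}) (subtopology K S) g"
    using assms(2) Hausdorff_K compact_Icc [of 0 "1::real"]
    by (intro continuous_imp_embedding_map Hausdorff_space_subtopology compact_space_subtopology) auto
  then have "g s = g 0 \<or> g s = g 1"
    using e assms(4,5) unfolding fan_endpoints_def by fastforce
  then show False
    using inj_onD [OF assms(2), of s 0] inj_onD [OF assms(2), of s 1] assms(4,5) by auto
qed

lemma continuous_q: "\<lbrakk>continuous_on A p; p ` A \<subseteq> cantor_set \<times> {0..1}\<rbrakk> \<Longrightarrow> continuous_map (top_of_set A) K (\<lambda>s. q (p s))"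
  using continuous_map_compose [OF _ quotient_imp_continuous_map [OF quotient], of "top_of_set A" p]
  by (auto simp: continuous_map_in_subtopology o_def)

lemma interior_not_endpoint:
  assumes c: "c \<in> cantor_set" and t: "0 \<le> t1" "t1 < t" "t < t2" "t2 \<le> 1"
    and S: "\<And>u. u \<in> {t1..t2} \<Longrightarrow> q (c, u) \<in> S"
  shows "q (c, t) \<notin> fan_endpoints (subtopology K S)"
proof -
  define u where "u s = t1 + s * (t2 - t1)" for s
  have u: "u s \<in> {t1..t2}" if "s \<in> {0..1}" for s
  proof -
    have "0 \<le> s * (t2 - t1)" "s * (t2 - t1) \<le> t2 - t1"
      using that t by (auto intro: mult_left_le_one_le)
    then show ?thesis by (simp add: u_def)
  qed
  have u01: "u s \<in> {0..1}" if "s \<in> {0..1}" for s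
    using u [OF that] t by auto
  have "continuous_map (top_of_set {0..1}) K (\<lambda>s. q (c, u s))"
    using u01 c by (intro continuous_q) (auto simp: u_def intro!: continuous_intros)
  moreover have "inj_on (\<lambda>s. q (c, u s)) {0..1}"
  proof (rule inj_onI)
    fix x y assume "x \<in> {0..1}" "y \<in> {0..1}" "q (c, u x) = q (c, u y)"
    then have "u x = u y" using q_eq_iff [OF c u01 c u01] by blast
    then show "x = y" using t by (simp add: u_def)
  qed
  moreover have "(\<lambda>s. q (c, u s)) ` {0..1} \<subseteq> S"
    using S u by blast
  ultimately have "q (c, u s) \<notin> fan_endpoints (subtopology K S)" if "0 < s" "s < 1" for s
    using not_endpoint that by blast
  moreover have "u ((t - t1) / (t2 - t1)) = t" "0 < (t - t1) / (t2 - t1)" "(t - t1) / (t2 - t1) < 1"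
    using t by (auto simp: u_def)
  ultimately show ?thesis by metis
qed

text \<open>Two blade segments concatenate at the vertex to an arc with the vertex in its interior.
  Every \<open>(c, 1)\<close> names the vertex, so \<open>c\<close> is arbitrary.\<close>

lemma vertex_not_endpoint:
  assumes c: "c1 \<in> cantor_set" "c2 \<in> cantor_set" "c1 \<noteq> c2" "c \<in> cantor_set"
    and t: "0 \<le> t1" "t1 < 1" "0 \<le> t2" "t2 < 1"
    and S: "\<And>u. u \<in> {t1..1} \<Longrightarrow> q (c1, u) \<in> S" "\<And>u. u \<in> {t2..1} \<Longrightarrow> q (c2, u) \<in> S"
  shows "q (c, 1) \<notin> fan_endpoints (subtopology K S)"
proof -
  define u v where "u s = t1 + 2 * s * (1 - t1)" and "v s = 1 - (2 * s - 1) * (1 - t2)" for s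
  define g where "g s = (if s \<le> 1/2 then q (c1, u s) else q (c2, v s))" for s
  have u: "u s \<in> {t1..1}" "u s \<in> {0..1}" if "s \<in> {0..1}" "s \<le> 1/2" for s
  proof -
    have "0 \<le> 2 * s * (1 - t1)" "2 * s * (1 - t1) \<le> 1 - t1"
      using that t by (auto intro: mult_left_le_one_le)
    then show "u s \<in> {t1..1}" "u s \<in> {0..1}"
      unfolding u_def atLeastAtMost_iff using t by linarith+
  qed
  have v: "v s \<in> {t2..1}" "v s \<in> {0..1}" if "s \<in> {0..1}" "1/2 \<le> s" for s
  proof -
    have "0 \<le> (2 * s - 1) * (1 - t2)" "(2 * s - 1) * (1 - t2) \<le> 1 - t2"
      using that t by (auto intro: mult_left_le_one_le)
    then show "v s \<in> {t2..1}" "v s \<in> {0..1}"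
      unfolding v_def atLeastAtMost_iff using t by linarith+
  qed
  \<comment> \<open>After \<open>1 / 2\<close> the path has left the vertex, the only point common
    to the two blades; this gives injectivity across the halves.\<close>
  have v1: "v s \<noteq> 1" if "1/2 < s" for s
    using that t by (simp add: v_def)
  have half: "u (1/2) = 1" "v (1/2) = 1" by (auto simp: u_def v_def)
  have "continuous_map (top_of_set {0..1}) K (\<lambda>s. if s \<le> 1/2 then q (c1, u s) else q (c2, v s))"
  proof (rule continuous_map_cases_le)
    have "continuous_map (top_of_set ({0..1} \<inter> {..1/2})) K (\<lambda>s. q (c1, u s))"
      using u c by (intro continuous_q) (auto simp: u_def intro!: continuous_intros)
    then show "continuous_map (subtopology (top_of_set {0..1}) {x \<in> topspace (top_of_set {0..1}). x \<le> 1/2}) K (\<lambda>s. q (c1, u s))"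
      by (rule back_subst [of "\<lambda>X. continuous_map X K (\<lambda>s. q (c1, u s))"])
         (auto simp: subtopology_subtopology intro!: arg_cong [of _ _ top_of_set])
    have "continuous_map (top_of_set ({0..1} \<inter> {1/2..})) K (\<lambda>s. q (c2, v s))"
      using v c by (intro continuous_q) (auto simp: v_def intro!: continuous_intros)
    then show "continuous_map (subtopology (top_of_set {0..1}) {x \<in> topspace (top_of_set {0..1}). 1/2 \<le> x}) K (\<lambda>s. q (c2, v s))"
      by (rule back_subst [of "\<lambda>X. continuous_map X K (\<lambda>s. q (c2, v s))"])
         (auto simp: subtopology_subtopology intro!: arg_cong [of _ _ top_of_set])
    show "q (c1, u x) = q (c2, v x)" if "x = 1/2" for x
      unfolding that half using q_eq_iff [of c1 1 c2 1] c by simp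
  qed (auto intro!: continuous_intros)
  then have "continuous_map (top_of_set {0..1}) K g"
    by (simp add: g_def [abs_def])
  moreover have "inj_on g {0..1}"
  proof (rule inj_onI)
    fix x y assume xy: "x \<in> {0..1}" "y \<in> {0..1}" "g x = g y"
    have mixed: False if "a \<in> {0..1}" "b \<in> {0..1}" "a \<le> 1/2" "1/2 < b" "g a = g b" for a b
    proof -
      have "q (c1, u a) = q (c2, v b)" using that by (simp add: g_def)
      then show False
        using q_eq_iff [of c1 "u a" c2 "v b"] c u(2) [of a] v(2) [of b] v1 [of b] that by auto
    qed
    consider "x \<le> 1/2" "y \<le> 1/2" | "1/2 < x" "1/2 < y" | "x \<le> 1/2" "1/2 < y" | "y \<le> 1/2" "1/2 < x"
      by linarith
    then show "x = y"
    proof cases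
      case 1
      then have "u x = u y"
        using xy q_eq_iff [of c1 "u x" c1 "u y"] c u(2) [of x] u(2) [of y] by (simp add: g_def)
      then show ?thesis using t by (simp add: u_def)
    next
      case 2
      then have "v x = v y"
        using xy q_eq_iff [of c2 "v x" c2 "v y"] c v(2) [of x] v(2) [of y] by (simp add: g_def)
      then show ?thesis using t by (simp add: v_def)
    qed (use mixed xy in metis)+
  qed
  moreover have "g ` {0..1} \<subseteq> S"
    using S u v by (auto simp: g_def)
  ultimately have "g (1/2) \<notin> fan_endpoints (subtopology K S)"
    by (intro not_endpoint) auto
  moreover have "g (1/2) = q (c, 1)"
    using half q_eq_iff [of c1 1 c 1] c by (simp add: g_def)
  ultimately show ?thesis by simp
qed

text \<open>Otherwise a clopen box around the lower part of the blade would disconnect \<open>S\<close>.\<close>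

lemma blade_upward:
  assumes c: "c \<in> cantor_set" and t: "t \<in> {0..1}" "q (c, t) \<in> S"
    and off: "\<exists>x\<in>S. x \<notin> q ` ({c} \<times> {0..1})"
    and u: "u \<in> {t..1}"
  shows "q (c, u) \<in> S"
proof (rule ccontr)
  assume nu: "q (c, u) \<notin> S"
  have u01: "u \<in> {0..1}" using u t by auto
  have tu: "t < u"
    using u nu t by (cases "t = u") auto
  obtain x where x: "x \<in> S" "x \<notin> q ` ({c} \<times> {0..1})" using off by blast
  have xK: "x \<in> topspace K" using x S_subset by blast
  have xc: "\<gamma> x \<noteq> c"
    using x q_coords [OF xK] \<tau>_in [OF xK] by (metis imageI insertI1 mem_Sigma_iff)
  have "c \<notin> fst ` (preS \<inter> UNIV \<times> {u})"
    using nu by (auto simp: preS_def)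
  then obtain d where d: "0 < d" "\<And>c' t. \<lbrakk>\<bar>c' - c\<bar> < d; (c', t) \<in> preS\<rbrakk> \<Longrightarrow> t \<notin> {u}"
    using slice_nhd [of "{u}" c] by blast
  \<comment> \<open>The second term keeps the blade of \<open>x\<close> outside the box, so that the
    other part of \<open>S\<close> is nonempty.\<close>
  define d' where "d' = min d \<bar>\<gamma> x - c\<bar>"
  have d': "0 < d'" using d xc by (simp add: d'_def)
  obtain r1 where r1: "r1 \<in> \<rat> - cantor_set" "c - d' < r1" "r1 < c"
    using rational_gap [of "c - d'" c] d' by auto
  obtain r2 where r2: "r2 \<in> \<rat> - cantor_set" "c < r2" "r2 < c + d'"
    using rational_gap [of c "c + d'"] d' by auto
  \<comment> \<open>The two closed sets overlap only on the sides and the top of the box. The sides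
    lie over gaps of the Cantor set and the top at the avoided height \<open>u\<close>, so the
    overlap misses \<open>preS\<close>.\<close>
  let ?P = "preS \<inter> {r1..r2} \<times> {..u}" and ?Q = "preS \<inter> ({..r1} \<times> UNIV \<union> {r2..} \<times> UNIV \<union> UNIV \<times> {u..})"
  have img: "closedin K (q ` A)" if "compact A" "A \<subseteq> cantor_set \<times> {0..1}" for A
    using that quotient_imp_continuous_map [OF quotient]
    by (intro compactin_imp_closedin [OF Hausdorff_K] image_compactin [of "top_of_set (cantor_set \<times> {0..1})"])
       (auto simp: compactin_subtopology)
  have cP: "compact ?P" and cQ: "compact ?Q"
    by (intro compact_Int_closed compact_preS closed_Times closed_Un; simp)+
  have sub: "?P \<subseteq> cantor_set \<times> {0..1}" "?Q \<subseteq> cantor_set \<times> {0..1}"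
    by (auto simp: preS_def)
  have box: "t' < u \<and> r1 < c' \<and> c' < r2" if "(c', t') \<in> ?P" for c' t'
  proof -
    have cC: "c' \<in> cantor_set" "(c', t') \<in> preS" "r1 \<le> c'" "c' \<le> r2" "t' \<le> u"
      using that by (auto simp: preS_def)
    then have "c' \<noteq> r1" "c' \<noteq> r2" using r1 r2 by auto
    moreover have "\<bar>c' - c\<bar> < d"
      using cC r1 r2 by (auto simp: d'_def abs_less_iff)
    then have "t' \<noteq> u" using d(2) cC by blast
    ultimately show ?thesis using cC by auto
  qed
  have "S \<subseteq> q ` ?P \<union> q ` ?Q"
  proof
    fix y assume y: "y \<in> S"
    then have yK: "y \<in> topspace K" using S_subset by blast
    have "(\<gamma> y, \<tau> y) \<in> preS"
      using y \<gamma>_in [OF yK] \<tau>_in [OF yK] q_coords [OF yK] by (auto simp: preS_def)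
    then have "(\<gamma> y, \<tau> y) \<in> ?P \<union> ?Q" by (auto simp: not_le)
    then have "q (\<gamma> y, \<tau> y) \<in> q ` ?P \<union> q ` ?Q"
      unfolding image_Un [symmetric] by (rule imageI)
    then show "y \<in> q ` ?P \<union> q ` ?Q"
      unfolding q_coords [OF yK] .
  qed
  moreover have "q ` ?P \<inter> q ` ?Q \<inter> S = {}"
  proof -
    have False if p: "(c1, t1) \<in> ?P" "(c2, t2) \<in> ?Q" "q (c1, t1) = q (c2, t2)" for c1 t1 c2 t2
    proof -
      have "t1 < u" "r1 < c1" "c1 < r2" using box p by auto
      \<comment> \<open>Heights in \<open>?P\<close> stay below \<open>u \<le> 1\<close>, so
        \<open>q\<close> identifies no distinct points here and disjointness survives in the
        quotient.\<close>
      moreover have "t1 = t2 \<and> (c1 = c2 \<or> t1 = 1)"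
        using q_eq_iff [of c1 t1 c2 t2] p by (auto simp: preS_def)
      ultimately show False using p(2) u01 by auto
    qed
    then have "q ` ?P \<inter> q ` ?Q = {}"
      unfolding disjoint_iff image_iff by (metis prod.collapse)
    then show ?thesis by blast
  qed
  moreover have "q ` ?P \<inter> S \<noteq> {}"
    using c t tu r1 r2 by (force simp: preS_def)
  moreover have "q ` ?Q \<inter> S \<noteq> {}"
  proof -
    have "(\<gamma> x, \<tau> x) \<in> preS"
      using x \<gamma>_in [OF xK] \<tau>_in [OF xK] q_coords [OF xK] by (auto simp: preS_def)
    moreover have "\<gamma> x \<le> r1 \<or> r2 \<le> \<gamma> x"
      using r1 r2 by (auto simp: d'_def)
    ultimately have "(\<gamma> x, \<tau> x) \<in> ?Q" by auto
    then have "q (\<gamma> x, \<tau> x) \<in> q ` ?Q" by (rule imageI)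
    then have "x \<in> q ` ?Q" unfolding q_coords [OF xK] .
    then show ?thesis using x by blast
  qed
  ultimately show False
    using connected_S img [OF cP sub(1)] img [OF cQ sub(2)] unfolding connectedin_closedin by blast
qed

lemma endpoint_in_S: "y \<in> fan_endpoints (subtopology K S) \<Longrightarrow> y \<in> S"
  by (simp add: fan_endpoints_def)

text \<open>If \<open>S\<close> lies in no single blade, it contains each blade upward from any of
  its points. The vertex is then interior to an arc along two blades, and a lower point with another
  point of \<open>preS\<close> beneath it is interior to a blade segment.\<close>

lemma
  assumes off: "\<And>c. c \<in> cantor_set \<Longrightarrow> \<exists>x\<in>S. x \<notin> q ` ({c} \<times> {0..1})"
    and y: "y \<in> fan_endpoints (subtopology K S)"
  shows endpoint_not_vertex: "\<tau> y < 1"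
    and endpoint_lowest: "(\<gamma> y, t) \<in> preS \<Longrightarrow> \<tau> y \<le> t"
proof -
  have yS: "y \<in> S" using endpoint_in_S [OF y] .
  then have yK: "y \<in> topspace K" using S_subset by blast
  have upward: "q (c, u) \<in> S" if "q (c, t) \<in> S" "c \<in> cantor_set" "t \<in> {0..1}" "u \<in> {t..1}" for c t u
    using blade_upward [OF that(2,3,1) off [OF that(2)] that(4)] .
  \<comment> \<open>Every blade contains the vertex, so a point off a blade has height below
    1.\<close>
  have other: "\<exists>c' t. c' \<in> cantor_set \<and> c' \<noteq> c \<and> 0 \<le> t \<and> t < 1 \<and> q (c', t) \<in> S" if c: "c \<in> cantor_set" for c
  proof -
    obtain x where x: "x \<in> S" "x \<notin> q ` ({c} \<times> {0..1})" using off [OF c] by blast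
    have xK: "x \<in> topspace K" using x S_subset by blast
    have "q (\<gamma> x, \<tau> x) \<notin> q ` ({c} \<times> {0..1})"
      using x q_coords [OF xK] by simp
    then have "\<gamma> x \<noteq> c" "q (\<gamma> x, \<tau> x) \<noteq> q (c, \<tau> x)"
      using \<tau>_in [OF xK] by auto
    then have "\<gamma> x \<noteq> c" "\<tau> x \<noteq> 1"
      using q_eq_iff [OF \<gamma>_in [OF xK] \<tau>_in [OF xK] c \<tau>_in [OF xK]] by auto
    then show ?thesis
      using \<gamma>_in [OF xK] \<tau>_in [OF xK] q_coords [OF xK] x by (intro exI [of _ "\<gamma> x"] exI [of _ "\<tau> x"]) auto
  qed
  show "\<tau> y < 1"
  proof (rule ccontr)
    assume "\<not> \<tau> y < 1"
    then have "\<tau> y = 1" using \<tau>_in [OF yK] by simp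
    then have y1: "y = q (\<gamma> y, 1)" using q_coords [OF yK] by simp
    obtain c1 t1 where 1: "c1 \<in> cantor_set" "0 \<le> t1" "t1 < 1" "q (c1, t1) \<in> S"
      using other [OF \<gamma>_in [OF yK]] by blast
    obtain c2 t2 where 2: "c2 \<in> cantor_set" "c2 \<noteq> c1" "0 \<le> t2" "t2 < 1" "q (c2, t2) \<in> S"
      using other [OF 1(1)] by blast
    have "q (\<gamma> y, 1) \<notin> fan_endpoints (subtopology K S)"
      using 1 2 upward \<gamma>_in [OF yK] by (intro vertex_not_endpoint [of c1 c2 _ t1 t2]) auto
    then show False using y y1 by simp
  qed
  show "\<tau> y \<le> t" if t: "(\<gamma> y, t) \<in> preS"
  proof (rule ccontr)
    assume "\<not> \<tau> y \<le> t"
    then have "q (\<gamma> y, \<tau> y) \<notin> fan_endpoints (subtopology K S)"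
      using t \<open>\<tau> y < 1\<close> upward [of "\<gamma> y" t]
      by (intro interior_not_endpoint [of _ t _ 1]) (auto simp: preS_def)
    then show False using y q_coords [OF yK] by simp
  qed
qed

text \<open>\<open>\<tau>\<close> is injective on one blade and the heights of \<open>S\<close> form
  an interval, so no endpoint lies strictly between two others; at most two remain.\<close>

lemma finite_endpoints_single_blade:
  assumes c: "c \<in> cantor_set" and S: "S \<subseteq> q ` ({c} \<times> {0..1})"
  shows "finite (fan_endpoints (subtopology K S))" (is "finite ?E")
proof -
  have "is_interval (\<tau> ` S)"
    using connectedin_continuous_map_image [OF continuous_\<tau> connected_S]
    by (simp add: is_interval_connected_1)
  moreover have onS: "x = q (c, \<tau> x) \<and> \<tau> x \<in> {0..1}" if "x \<in> S" for x
    using that S \<tau>_q [OF c] by auto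
  ultimately have mid: "q (c, u) \<in> S" if "x \<in> S" "y \<in> S" "u \<in> {\<tau> x..\<tau> y}" for x y u
  proof -
    have "u \<in> \<tau> ` S"
      using that \<open>is_interval (\<tau> ` S)\<close> unfolding is_interval_1 by (meson atLeastAtMost_iff imageI)
    then show ?thesis using onS by auto
  qed
  have no_mid: False if "x \<in> ?E" "y \<in> ?E" "z \<in> ?E" "\<tau> x < \<tau> y" "\<tau> y < \<tau> z" for x y z
  proof -
    have xyz: "x \<in> S" "y \<in> S" "z \<in> S" using that endpoint_in_S by auto
    have "q (c, \<tau> y) \<notin> ?E"
      using onS [OF xyz(1)] onS [OF xyz(3)] mid [OF xyz(1,3)] that
      by (intro interior_not_endpoint [OF c, of "\<tau> x" _ "\<tau> z"]) auto
    then show False using that onS [OF xyz(2)] by simp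
  qed
  have inj: "\<tau> x \<noteq> \<tau> y" if "x \<in> ?E" "y \<in> ?E" "x \<noteq> y" for x y
    using that onS endpoint_in_S by metis
  show ?thesis
  proof (cases "\<exists>x y. x \<in> ?E \<and> y \<in> ?E \<and> \<tau> x < \<tau> y")
    case True
    then obtain x y where xy: "x \<in> ?E" "y \<in> ?E" "\<tau> x < \<tau> y" by blast
    have "z = x \<or> z = y" if z: "z \<in> ?E" for z
    proof (rule ccontr)
      assume "\<not> (z = x \<or> z = y)"
      then have "\<tau> z \<noteq> \<tau> x" "\<tau> z \<noteq> \<tau> y" using inj z xy by auto
      then consider "\<tau> z < \<tau> x" | "\<tau> x < \<tau> z" "\<tau> z < \<tau> y" | "\<tau> y < \<tau> z" by linarith
      then show False
        by cases (use no_mid [OF z xy(1,2)] no_mid [OF xy(1) z xy(2)] no_mid [OF xy(1,2) z] xy in auto)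
    qed
    then have "?E \<subseteq> {x, y}" by blast
    then show ?thesis by (rule finite_subset) simp
  next
    case False
    then have "x = y" if "x \<in> ?E" "y \<in> ?E" for x y
      using inj that by (meson linorder_less_linear)
    then show ?thesis
      by (metis finite.simps finite_subset insertI1 subsetI)
  qed
qed

section \<open>Endpoint sets as graphs of the height function\<close>

lemma lsc_graph_endpoints:
  assumes off: "\<And>c. c \<in> cantor_set \<Longrightarrow> \<exists>x\<in>S. x \<notin> q ` ({c} \<times> {0..1})"
    and Y: "Y \<subseteq> fan_endpoints (subtopology K S)"
  shows "lsc_graph (subtopology K Y)
           (\<lambda>i. {y \<in> Y. \<gamma> y < from_nat_into (\<rat> - cantor_set) i}) \<tau>"
proof -
  let ?r = "from_nat_into (\<rat> - cantor_set)"
  let ?H = "\<lambda>i. {y \<in> Y. \<gamma> y < ?r i}"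
  have YS: "Y \<subseteq> S" using Y endpoint_in_S by blast
  then have YK: "Y \<subseteq> topspace K" using S_subset by blast
  have topY: "topspace (subtopology K Y) = Y" using YK by auto
  have cl: "\<tau> y < 1" "(\<gamma> y, t) \<in> preS \<Longrightarrow> \<tau> y \<le> t" if "y \<in> Y" for y t
    using endpoint_not_vertex [OF off] endpoint_lowest [OF off] that Y by auto
  have cnt: "countable (\<rat> - cantor_set)"
    using countable_rat by blast
  have ne: "\<rat> - cantor_set \<noteq> {}"
    using rational_gap [of 0 1] by auto
  have r: "?r i \<notin> cantor_set" for i
    using from_nat_into [OF ne] by blast
  have cont_\<tau>: "continuous_map (subtopology K Y) euclideanreal \<tau>"
    using continuous_\<tau> continuous_map_from_subtopology by blast
  have "continuous_map (subtopology K Y) euclideanreal (\<lambda>x. 1 - \<tau> x)"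
    using cont_\<tau> by (auto intro!: continuous_intros)
  \<comment> \<open>Endpoints avoid the vertex, so dividing the continuous width by
    \<open>1 - \<tau>\<close> recovers \<open>\<gamma>\<close>, which is therefore continuous on
    \<open>Y\<close>.\<close>
  then have "continuous_map (subtopology K Y) euclideanreal (\<lambda>x. ((1 - \<tau> x) * \<gamma> x) / (1 - \<tau> x))"
    by (rule continuous_map_real_divide [OF continuous_map_from_subtopology [OF continuous_width]])
       (auto simp: topY dest: cl(1))
  then have cont_\<gamma>: "continuous_map (subtopology K Y) euclideanreal \<gamma>"
    by (rule continuous_map_eq) (auto simp: topY dest: cl(1))
  have near: "\<exists>n. \<forall>y\<in>Y. agree ?H n x y \<longrightarrow> \<bar>\<gamma> y - \<gamma> x\<bar> < d" if x: "x \<in> Y" and d: "0 < d" for x d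
  proof -
    obtain r1 where r1: "r1 \<in> \<rat> - cantor_set" "\<gamma> x - d < r1" "r1 < \<gamma> x"
      using rational_gap [of "\<gamma> x - d" "\<gamma> x"] d by auto
    obtain r2 where r2: "r2 \<in> \<rat> - cantor_set" "\<gamma> x < r2" "r2 < \<gamma> x + d"
      using rational_gap [of "\<gamma> x" "\<gamma> x + d"] d by auto
    obtain i1 i2 where i: "?r i1 = r1" "?r i2 = r2"
      using from_nat_into_surj [OF cnt r1(1)] from_nat_into_surj [OF cnt r2(1)] by blast
    have "\<bar>\<gamma> y - \<gamma> x\<bar> < d" if y: "y \<in> Y" "agree ?H (Suc (max i1 i2)) x y" for y
    proof -
      have "x \<in> ?H i \<longleftrightarrow> y \<in> ?H i" if "i < Suc (max i1 i2)" for i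
        using y(2) that unfolding agree_def by blast
      from this [of i1] this [of i2] have "\<not> \<gamma> y < r1" "\<gamma> y < r2"
        using i r1 r2 \<open>x \<in> Y\<close> y(1) by auto
      then show ?thesis using r1 r2 by linarith
    qed
    then show ?thesis by blast
  qed
  have low: "\<exists>n. \<forall>y\<in>Y. agree ?H n x y \<longrightarrow> \<tau> x - e < \<tau> y" if x: "x \<in> Y" and "0 < e" for x e
  proof -
    \<comment> \<open>An endpoint is the lowest point on its blade, so heights up to
      \<open>\<tau> x - e\<close> are missing there and hence on nearby blades; this is the source
      of lower semicontinuity.\<close>
    have "\<gamma> x \<notin> fst ` (preS \<inter> UNIV \<times> {..\<tau> x - e})"
      using cl(2) [OF x] \<open>0 < e\<close> by force
    then obtain d where d: "0 < d" "\<And>c' t. \<lbrakk>\<bar>c' - \<gamma> x\<bar> < d; (c', t) \<in> preS\<rbrakk> \<Longrightarrow> t \<notin> {..\<tau> x - e}"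
      using slice_nhd [of "{..\<tau> x - e}"] by blast
    obtain n where n: "\<forall>y\<in>Y. agree ?H n x y \<longrightarrow> \<bar>\<gamma> y - \<gamma> x\<bar> < d"
      using near [OF x d(1)] by blast
    have "\<tau> x - e < \<tau> y" if y: "y \<in> Y" "agree ?H n x y" for y
    proof -
      have yK: "y \<in> topspace K" using y YK by blast
      have "(\<gamma> y, \<tau> y) \<in> preS"
        using y YS \<gamma>_in [OF yK] \<tau>_in [OF yK] q_coords [OF yK] by (auto simp: preS_def)
      then show ?thesis using d(2) n y by fastforce
    qed
    then show ?thesis by blast
  qed
  show ?thesis
  proof
    fix i
    have "openin (subtopology K Y) {y \<in> topspace (subtopology K Y). \<gamma> y \<in> {..<?r i}}"
      by (rule openin_continuous_map_preimage [OF cont_\<gamma>]) simp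
    then show "openin (subtopology K Y) (?H i)" unfolding topY lessThan_iff .
    have "closedin (subtopology K Y) {y \<in> topspace (subtopology K Y). \<gamma> y \<in> {..?r i}}"
      by (rule closedin_continuous_map_preimage [OF cont_\<gamma>]) simp
    \<comment> \<open>The cut lies in a gap, so the strict and the weak inequality define the same
      subset of \<open>Y\<close>.\<close>
    moreover have "\<gamma> y \<noteq> ?r i" if "y \<in> Y" for y
      using r [of i] \<gamma>_in [of y] YK that by auto
    then have "?H i = {y \<in> topspace (subtopology K Y). \<gamma> y \<in> {..?r i}}"
      unfolding topY by force
    ultimately show "closedin (subtopology K Y) (?H i)" by simp
  next
    show "continuous_map (subtopology K Y) euclideanreal \<tau>" by (rule cont_\<tau>)
  next
    show "\<exists>n. \<forall>y \<in> topspace (subtopology K Y). agree ?H n x y \<longrightarrow> \<tau> x - e < \<tau> y"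
      if "x \<in> topspace (subtopology K Y)" "0 < e" for x e
      using low that unfolding topY by blast
  next
    fix x G
    assume "openin (subtopology K Y) G" "x \<in> G"
    then obtain G' where G': "openin K G'" "G = G' \<inter> Y" and x: "x \<in> Y" "x \<in> G'"
      by (auto simp: openin_subtopology)
    have xK: "x \<in> topspace K" using x YK by blast
    have "openin (top_of_set (cantor_set \<times> {0..1})) {p \<in> cantor_set \<times> {0..1}. q p \<in> G'}"
      using openin_continuous_map_preimage [OF quotient_imp_continuous_map [OF quotient] G'(1)] by simp
    then obtain O' where O': "open O'" "{p \<in> cantor_set \<times> {0..1}. q p \<in> G'} = cantor_set \<times> {0..1} \<inter> O'"
      by (auto simp: openin_open)
    have "(\<gamma> x, \<tau> x) \<in> {p \<in> cantor_set \<times> {0..1}. q p \<in> G'}"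
      using \<gamma>_in [OF xK] \<tau>_in [OF xK] q_coords [OF xK] x by simp
    then have "(\<gamma> x, \<tau> x) \<in> O'" using O'(2) by blast
    then obtain A B where AB: "open A" "open B" "(\<gamma> x, \<tau> x) \<in> A \<times> B" "A \<times> B \<subseteq> O'"
      using open_prod_elim [OF O'(1)] by metis
    obtain d where d: "0 < d" "ball (\<gamma> x) d \<subseteq> A" using AB by (auto elim: openE)
    obtain e where e: "0 < e" "ball (\<tau> x) e \<subseteq> B" using AB by (auto elim: openE)
    obtain n where n: "\<forall>y\<in>Y. agree ?H n x y \<longrightarrow> \<bar>\<gamma> y - \<gamma> x\<bar> < d"
      using near [OF x(1) d(1)] by blast
    obtain m where m: "\<forall>y\<in>Y. agree ?H m x y \<longrightarrow> \<tau> x - e < \<tau> y"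
      using low [OF x(1) e(1)] by blast
    \<comment> \<open>Agreement bounds \<open>\<tau> y\<close> from below through
      \<open>low\<close>, so a bound from above completes the box.\<close>
    have "y \<in> G" if y: "y \<in> Y" "agree ?H (max n m) x y" "\<tau> y < \<tau> x + e" for y
    proof -
      have yK: "y \<in> topspace K" using y YK by blast
      have "\<bar>\<gamma> y - \<gamma> x\<bar> < d" "\<tau> x - e < \<tau> y"
        using n m y(1) agree_mono [OF y(2)] by auto
      then have "\<gamma> y \<in> A" "\<tau> y \<in> B"
        using subsetD [OF d(2), of "\<gamma> y"] subsetD [OF e(2), of "\<tau> y"] y(3)
        by (auto simp: dist_real_def)
      then have "(\<gamma> y, \<tau> y) \<in> cantor_set \<times> {0..1} \<inter> O'"
        using AB(4) \<gamma>_in [OF yK] \<tau>_in [OF yK] by blast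
      then have "q (\<gamma> y, \<tau> y) \<in> G'"
        unfolding O'(2) [symmetric] by simp
      then show ?thesis
        using q_coords [OF yK] y(1) G'(2) by simp
    qed
    then show "\<exists>n e. 0 < e \<and> (\<forall>y \<in> topspace (subtopology K Y). agree ?H n x y \<and> \<tau> y < \<tau> x + e \<longrightarrow> y \<in> G)"
      unfolding topY using e(1) by blast
  qed
qed

text \<open>Inside a single blade the endpoints are finite in number and the subspace is discrete;
  otherwise the graph description applies.\<close>

lemma topdim_dim_kernel_endpoints:
  assumes Y: "Y \<subseteq> fan_endpoints (subtopology K S)"
  shows "topdim (subtopology (subtopology K Y) (dim_kernel (subtopology K Y))) = topdim (subtopology K Y)"
proof (cases "\<exists>c \<in> cantor_set. S \<subseteq> q ` ({c} \<times> {0..1})")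
  case True
  then have "finite Y"
    using finite_endpoints_single_blade Y finite_subset by blast
  then have "subtopology K Y = discrete_topology (topspace K \<inter> Y)"
    using Hausdorff_K by (intro subtopology_eq_discrete_topology_gen_finite Hausdorff_imp_t1_space)
  then have "subtopology K Y dim_le 0"
    by (simp add: dimension_le_0_neighbourhood_base_of_clopen neighbourhood_base_of_discrete_topology)
  then show ?thesis
    by (rule topdim_dim_kernel_zero)
next
  case False
  then have "\<exists>x\<in>S. x \<notin> q ` ({c} \<times> {0..1})" if "c \<in> cantor_set" for c
    using that by blast
  then interpret lsc_graph "subtopology K Y" "\<lambda>i. {y \<in> Y. \<gamma> y < from_nat_into (\<rat> - cantor_set) i}" \<tau>
    using lsc_graph_endpoints Y by blast
  show ?thesis
    by (intro topdim_dim_kernel second_countable_subtopology second_countable_K)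
qed

end

theorem corollary3:
  fixes X :: "'a topology"
  assumes "smooth_fan X"
  shows "(\<forall>Y. Y \<subseteq> fan_endpoints X \<longrightarrow>
             topdim (subtopology X (dim_kernel (subtopology X Y))) = topdim (subtopology X Y)) \<and>
         \<not> (\<exists>Y. Y \<subseteq> fan_endpoints X \<and> weakly_one_dimensional (subtopology X Y))"
proof -
  obtain K S q where KS: "compactin K S" "connectedin K S" and X: "X = subtopology K S"
    and q: "quotient_map (prod_topology (top_of_set cantor_set) (top_of_set {0..1::real})) K q"
      "\<And>x y. \<lbrakk>x \<in> cantor_set \<times> {0..1}; y \<in> cantor_set \<times> {0..1}\<rbrakk> \<Longrightarrow>
         q x = q y \<longleftrightarrow> x = y \<or> (snd x = 1 \<and> snd y = 1)"
    using assms unfolding smooth_fan_def cantor_fan_def is_cone_over_def by auto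
  interpret fan K q S
    using KS q by unfold_locales auto
  \<comment> \<open>Weak one-dimensionality restricts twice, the claimed equation only once; the
    results agree since the kernel lies in \<open>Y\<close>.\<close>
  have kernel: "subtopology (subtopology X Y) (dim_kernel (subtopology X Y)) =
      subtopology X (dim_kernel (subtopology X Y))" for Y
    using dim_kernel_subset [of "subtopology X Y"] by (simp add: subtopology_subtopology Int_absorb1)
  have main: "topdim (subtopology X (dim_kernel (subtopology X Y))) = topdim (subtopology X Y)"
    if Y: "Y \<subseteq> fan_endpoints X" for Y
  proof -
    have "Y \<subseteq> S" using Y endpoint_in_S X by blast
    then have "subtopology X Y = subtopology K Y"
      by (simp add: X subtopology_subtopology Int_absorb1)
    then show ?thesis
      using topdim_dim_kernel_endpoints [of Y] Y kernel [of Y] X by simp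
  qed
  moreover have "\<not> weakly_one_dimensional (subtopology X Y)" if "Y \<subseteq> fan_endpoints X" for Y
    using main [OF that] kernel [of Y] unfolding weakly_one_dimensional_def by simp
  ultimately show ?thesis by blast
qed

end
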